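(* Let $M$ be an acyclic oriented matroid on a nonempty finite set $E$. The number of transitive $2$-colorings of $M$ is equal to $2^c$ times the number of acyclic reorientations of $M$, where $c$ is the number of connected components of $M$.
   Context: An oriented matroid is acyclic if it has no positive circuit (no signed circuit $X=(X^+,X^-)$ with $X^-=\varnothing$). A transitive $2$-coloring of $M$ is a function $\varepsilon:E\to\{1,2\}$ such that $\varepsilon(X^+)\cap\varepsilon(X^-)\ne\varnothing$ for every signed circuit $X=(X^+,X^-)$ of $M$. For $A\subseteq E$ and a signed set $X$ with support in $E$, ${}_{-A}X$ is obtained from $X$ by reversing the signs of all elements of $A$ in the support of $X$; ${}_{-A}M$ is the oriented matroid whose signed circuits are the ${}_{-A}X$ for $X$ a signed circuit of $M$. A reorientation of $M$ is any oriented matroid of the form ${}_{-A}M$, $A\subseteq E$; reorientations are counted as distinct oriented matroids on $E$ (so different $A$ giving the same oriented matroid are counted once). The connected components of $M$ are the equivalence classes of the relation on $E$: $e\sim f$ iff $e=f$ or $\{e,f\}$ is contained in (the support of) a circuit of $M$. *)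

theory Defs
  imports Main "HOL-Library.FuncSet"
begin

text \<open>A signed set \<open>X\<close> is the pair \<open>(X\<^sup>+, X\<^sup>-)\<close>; disjointness of the two parts is required of
  the signed circuits in the definition of oriented matroids below.\<close>

type_synonym 'a signed_set = "'a set \<times> 'a set"

abbreviation pos :: "'a signed_set \<Rightarrow> 'a set" where "pos X \<equiv> fst X"
abbreviation neg :: "'a signed_set \<Rightarrow> 'a set" where "neg X \<equiv> snd X"

definition supp :: "'a signed_set \<Rightarrow> 'a set" where
  "supp X = pos X \<union> neg X"

definition opp :: "'a signed_set \<Rightarrow> 'a signed_set" where
  "opp X = (neg X, pos X)"

record 'a om =
  ground :: "'a set"
  circuits :: "'a signed_set set"

text \<open>The signed circuit axioms, with weak elimination.\<close>

definition oriented_matroid :: "'a om \<Rightarrow> bool" where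
  "oriented_matroid M \<longleftrightarrow>
     finite (ground M) \<and>
     (\<forall>X\<in>circuits M. pos X \<inter> neg X = {} \<and> supp X \<subseteq> ground M) \<and>
     ({}, {}) \<notin> circuits M \<and>
     (\<forall>X\<in>circuits M. opp X \<in> circuits M) \<and>
     (\<forall>X\<in>circuits M. \<forall>Y\<in>circuits M. supp X \<subseteq> supp Y \<longrightarrow> X = Y \<or> X = opp Y) \<and>
     (\<forall>X\<in>circuits M. \<forall>Y\<in>circuits M. \<forall>e. X \<noteq> opp Y \<and> e \<in> pos X \<inter> neg Y \<longrightarrow>
        (\<exists>Z\<in>circuits M. pos Z \<subseteq> (pos X \<union> pos Y) - {e} \<and> neg Z \<subseteq> (neg X \<union> neg Y) - {e}))"

definition acyclic_om :: "'a om \<Rightarrow> bool" where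
  "acyclic_om M \<longleftrightarrow> \<not> (\<exists>X\<in>circuits M. neg X = {})"

text \<open>Colourings are functions on the ground set only, hence the extensional function space.\<close>

definition transitive_2_colorings :: "'a om \<Rightarrow> ('a \<Rightarrow> nat) set" where
  "transitive_2_colorings M =
     {\<epsilon> \<in> ground M \<rightarrow>\<^sub>E {1, 2}. \<forall>X\<in>circuits M. \<epsilon> ` pos X \<inter> \<epsilon> ` neg X \<noteq> {}}"

definition reverse_signs :: "'a set \<Rightarrow> 'a signed_set \<Rightarrow> 'a signed_set" where
  "reverse_signs A X = ((pos X - A) \<union> (neg X \<inter> A), (neg X - A) \<union> (pos X \<inter> A))"

definition reorient :: "'a set \<Rightarrow> 'a om \<Rightarrow> 'a om" where
  "reorient A M = \<lparr>ground = ground M, circuits = reverse_signs A ` circuits M\<rparr>"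

definition reorientations :: "'a om \<Rightarrow> 'a om set" where
  "reorientations M = {reorient A M | A. A \<subseteq> ground M}"

definition connected_rel :: "'a om \<Rightarrow> ('a \<times> 'a) set" where
  "connected_rel M =
     {(e, f). e \<in> ground M \<and> f \<in> ground M \<and> (e = f \<or> (\<exists>X\<in>circuits M. {e, f} \<subseteq> supp X))}"

definition connected_components :: "'a om \<Rightarrow> 'a set set" where
  "connected_components M = ground M // connected_rel M"

lemma reverse_signs_involution: "pos X \<inter> neg X = {} \<Longrightarrow> reverse_signs A (reverse_signs A X) = X"
  by (cases X) (auto simp: reverse_signs_def)

lemma supp_reverse_signs: "supp (reverse_signs A X) = supp X"
  by (auto simp: supp_def reverse_signs_def)

lemma opp_opp: "opp (opp X) = X"
  by (simp add: opp_def)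

lemma opp_reverse_signs: "opp (reverse_signs A X) = reverse_signs A (opp X)"
  by (simp add: opp_def reverse_signs_def)

lemma oriented_matroid_reorient:
  assumes "oriented_matroid M"
  shows "oriented_matroid (reorient A M)"
proof -
  let ?r = "reverse_signs A"
  note M = assms[unfolded oriented_matroid_def]
  have M_elim: "\<exists>Z\<in>circuits M. pos Z \<subseteq> (pos X \<union> pos Y) - {e} \<and> neg Z \<subseteq> (neg X \<union> neg Y) - {e}"
    if "X \<in> circuits M" "Y \<in> circuits M" "X \<noteq> opp Y" "e \<in> pos X \<inter> neg Y" for X Y e
    using M[THEN conjunct2, THEN conjunct2, THEN conjunct2, THEN conjunct2, THEN conjunct2,
        rule_format, OF that(1,2) conjI[OF that(3,4)]] .
  have elim: "\<exists>Z\<in>circuits M. pos (?r Z) \<subseteq> (pos (?r X) \<union> pos (?r Y)) - {e}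
      \<and> neg (?r Z) \<subseteq> (neg (?r X) \<union> neg (?r Y)) - {e}"
    if X: "X \<in> circuits M" and Y: "Y \<in> circuits M" and ne: "?r X \<noteq> opp (?r Y)"
      and e: "e \<in> pos (?r X) \<inter> neg (?r Y)" for X Y e
  proof -
    have "X \<noteq> opp Y" using ne by (auto simp: opp_reverse_signs)
    then have neq: "X \<noteq> opp Y" "Y \<noteq> opp X" by (auto simp: opp_opp)
    have "e \<in> pos X \<inter> neg Y \<or> e \<in> pos Y \<inter> neg X"
      using e unfolding reverse_signs_def by auto
    then have "\<exists>Z\<in>circuits M. pos Z \<subseteq> (pos X \<union> pos Y) - {e} \<and> neg Z \<subseteq> (neg X \<union> neg Y) - {e}"
    proof
      assume "e \<in> pos X \<inter> neg Y"
      with M_elim X Y neq(1) show ?thesis by blast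
    next
      assume "e \<in> pos Y \<inter> neg X"
      from M_elim[OF Y X neq(2) this] show ?thesis by (simp only: Un_commute)
    qed
    then obtain Z where Z: "Z \<in> circuits M"
      "pos Z \<subseteq> (pos X \<union> pos Y) - {e}" "neg Z \<subseteq> (neg X \<union> neg Y) - {e}"
      by (elim bexE conjE)
    have "pos (?r Z) \<subseteq> (pos (?r X) \<union> pos (?r Y)) - {e}"
      using Z(2,3) unfolding reverse_signs_def by auto
    moreover have "neg (?r Z) \<subseteq> (neg (?r X) \<union> neg (?r Y)) - {e}"
      using Z(2,3) unfolding reverse_signs_def by auto
    ultimately show ?thesis using Z(1) by (intro bexI conjI)
  qed
  have nonempty: "?r X \<noteq> ({}, {})" if "X \<in> circuits M" for X
  proof
    assume "?r X = ({}, {})"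
    then have "supp X = {}" using supp_reverse_signs[of A X] by (simp add: supp_def)
    then have "X = ({}, {})" by (simp add: supp_def prod_eq_iff)
    then show False using that M by simp
  qed
  have signed: "pos (?r X) \<inter> neg (?r X) = {} \<and> supp (?r X) \<subseteq> ground M"
    if "X \<in> circuits M" for X
  proof
    have "pos X \<inter> neg X = {}" using M that by simp
    then show "pos (?r X) \<inter> neg (?r X) = {}" unfolding reverse_signs_def by auto
    show "supp (?r X) \<subseteq> ground M" using M that by (simp add: supp_reverse_signs)
  qed
  have opp: "opp (?r X) \<in> ?r ` circuits M" if "X \<in> circuits M" for X
    using M that by (simp add: opp_reverse_signs)
  have incomp: "?r X = ?r Y \<or> ?r X = opp (?r Y)"
    if "X \<in> circuits M" "Y \<in> circuits M" "supp (?r X) \<subseteq> supp (?r Y)" for X Y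
  proof -
    have "supp X \<subseteq> supp Y" using that(3) by (simp only: supp_reverse_signs)
    then have "X = Y \<or> X = opp Y" using M that(1,2) by simp
    then show ?thesis by (auto simp: opp_reverse_signs)
  qed
  have fin: "finite (ground M)"
    using M by simp
  have "({}, {}) \<notin> ?r ` circuits M"
    using nonempty by fastforce
  with fin signed opp incomp elim show ?thesis
    unfolding oriented_matroid_def reorient_def om.select_convs ball_simps bex_simps
    by (intro conjI ballI allI impI) (simp_all del: Int_iff)
qed

end

theory Submission
  imports Defs
begin

text \<open>Identify a 2-colouring with the set \<open>A\<close> of elements of colour 2. As \<open>M\<close> is acyclic, both
  parts of a signed circuit \<open>X\<close> are nonempty, so the colours of \<open>X\<^sup>+\<close> and \<open>X\<^sup>-\<close> are disjoint exactly
  when one part lies in \<open>A\<close> and the other one avoids \<open>A\<close>, that is, when reversing \<open>A\<close> makes \<open>X\<close>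
  positive or negative. Hence the transitive colourings correspond to the sets \<open>A\<close> whose
  reorientation is acyclic. Two sets give the same reorientation iff their symmetric difference
  contains or avoids the support of each circuit, that is, iff it is a union of connected
  components, so every reorientation arises from \<open>2\<^sup>c\<close> sets.\<close>

section \<open>Unsigned circuits: elimination and circuits through two given elements\<close>

text \<open>Connected components depend only on the supports of circuits, so the arguments about
  them are carried out on these sets, free of signs.\<close>

locale circuit_family =
  fixes \<C> :: "'a set set"
  assumes finite_circuit: "C \<in> \<C> \<Longrightarrow> finite C"
    and incomparable: "C \<in> \<C> \<Longrightarrow> D \<in> \<C> \<Longrightarrow> C \<subseteq> D \<Longrightarrow> C = D"
    and weak_elimination:
      "C \<in> \<C> \<Longrightarrow> D \<in> \<C> \<Longrightarrow> C \<noteq> D \<Longrightarrow> e \<in> C \<inter> D \<Longrightarrow> \<exists>Z\<in>\<C>. Z \<subseteq> C \<union> D - {e}"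
begin

text \<open>Provides the decrease for the two inductions on the size of the union of two circuits:
  the new pair stays inside the old union and loses \<open>g\<close>.\<close>

lemma card_union_less:
  assumes "C \<in> \<C>" "D \<in> \<C>" "C' \<union> D' \<subseteq> C \<union> D" "g \<in> C \<union> D" "g \<notin> C' \<union> D'"
  shows "card (C' \<union> D') < card (C \<union> D)"
  using assms by (intro psubset_card_mono) (auto simp: finite_circuit)

text \<open>If weak elimination of \<open>e\<close> yields a circuit \<open>Z\<close> without
  \<open>f\<close>, two smaller instances repair it. The pair \<open>D\<close>, \<open>Z\<close>
  misses \<open>f\<close> and gives a circuit \<open>Y\<close> that keeps \<open>e\<close> but drops
  some \<open>g\<close>; the pair \<open>C\<close>, \<open>Y\<close> misses \<open>g\<close>, and
  eliminating \<open>e\<close> from it keeps \<open>f\<close>.\<close>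

lemma strong_elimination:
  assumes "C \<in> \<C>" "D \<in> \<C>" "e \<in> C \<inter> D" "f \<in> C - D"
  shows "\<exists>Z\<in>\<C>. f \<in> Z \<and> Z \<subseteq> C \<union> D - {e}"
  using assms
proof (induction "card (C \<union> D)" arbitrary: C D e f rule: less_induct)
  case less
  obtain Z where Z: "Z \<in> \<C>" "Z \<subseteq> C \<union> D - {e}"
    using weak_elimination[of C D e] less.prems by blast
  show ?case
  proof (cases "f \<in> Z")
    case True
    with Z show ?thesis by blast
  next
    case False
    \<comment> \<open>Otherwise \<open>Z = C\<close> by incomparability, although \<open>e\<close>
      lies in \<open>C\<close> and not in \<open>Z\<close>.\<close>
    have "\<not> Z \<subseteq> C"
      using incomparable[OF Z(1) less.prems(1)] Z(2) less.prems(3) by blast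
    then obtain g where g: "g \<in> Z" "g \<in> D" "g \<notin> C" using Z(2) by blast
    have "card (D \<union> Z) < card (C \<union> D)"
      using Z False less.prems by (intro card_union_less[where g = f]) auto
    from less.hyps[OF this less.prems(2) Z(1), of g e]
    obtain Y where Y: "Y \<in> \<C>" "e \<in> Y" "Y \<subseteq> D \<union> Z - {g}"
      using g Z less.prems by blast
    have "card (C \<union> Y) < card (C \<union> D)"
      using Z Y g less.prems by (intro card_union_less[where g = g]) auto
    from less.hyps[OF this less.prems(1) Y(1), of e f]
    obtain W where "W \<in> \<C>" "f \<in> W" "W \<subseteq> C \<union> Y - {e}"
      using Y False less.prems by blast
    with Y Z show ?thesis by blast
  qed
qed

text \<open>This is what makes the connectivity relation transitive. Eliminating a common element
  \<open>y\<close> while keeping \<open>x\<close> or \<open>z\<close> gives circuits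
  \<open>C'\<close> and \<open>D'\<close>, from which a meeting pair with a smaller union is
  chosen.\<close>

lemma circuit_through_meeting_circuits:
  assumes "C \<in> \<C>" "D \<in> \<C>" "C \<inter> D \<noteq> {}" "x \<in> C" "z \<in> D"
  shows "\<exists>Z\<in>\<C>. x \<in> Z \<and> z \<in> Z"
  using assms
proof (induction "card (C \<union> D)" arbitrary: C D rule: less_induct)
  case less
  show ?case
  proof (cases "x \<in> D \<or> z \<in> C")
    case True
    with less.prems show ?thesis by blast
  next
    case False
    from less.prems obtain y where y: "y \<in> C \<inter> D" by blast
    obtain C' where C': "C' \<in> \<C>" "x \<in> C'" "C' \<subseteq> C \<union> D - {y}"
      using strong_elimination[OF less.prems(1,2) y, of x] less.prems False by blast
    obtain D' where D': "D' \<in> \<C>" "z \<in> D'" "D' \<subseteq> D \<union> C - {y}"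
      using strong_elimination[OF less.prems(2,1), of y z] y less.prems False by blast
    \<comment> \<open>A circuit avoiding \<open>y\<close> cannot lie inside \<open>C\<close> or
      inside \<open>D\<close>, since it would then equal a circuit containing \<open>y\<close>. So
      \<open>C'\<close> leaves \<open>C\<close> and \<open>D'\<close> leaves
      \<open>D\<close>.\<close>
    have C'D: "C' \<inter> D \<noteq> {}"
      using incomparable[OF C'(1) less.prems(1)] C'(3) y by blast
    have D'C: "D' \<inter> (C - D) \<noteq> {}"
      using incomparable[OF D'(1) less.prems(2)] D'(3) y by blast
    \<comment> \<open>If \<open>C'\<close> contains \<open>C - D\<close>, it meets \<open>D'\<close>
      there, and both avoid \<open>y\<close>. Otherwise \<open>C'\<close> misses some
      \<open>g\<close> in \<open>C - D\<close>, and replacing \<open>C\<close> by \<open>C'\<close>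
      removes \<open>g\<close> from the union.\<close>
    show ?thesis
    proof (cases "C - D \<subseteq> C'")
      case True
      have "card (C' \<union> D') < card (C \<union> D)"
        using C' D' y less.prems by (intro card_union_less[where g = y]) auto
      then show ?thesis
        using True D'C C' D' by (intro less.hyps[of C' D']) auto
    next
      case False
      then obtain g where "g \<in> C" "g \<notin> D" "g \<notin> C'" by blast
      then have "card (C' \<union> D) < card (C \<union> D)"
        using C' less.prems by (intro card_union_less[where g = g]) auto
      then show ?thesis
        using C' C'D less.prems by (intro less.hyps[of C' D]) auto
    qed
  qed
qed

end

section \<open>From signed circuits to the connectivity relation\<close>

lemma oriented_matroidD:
  assumes "oriented_matroid M"
  shows "finite (ground M)"
    and "X \<in> circuits M \<Longrightarrow> pos X \<inter> neg X = {}"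
    and "X \<in> circuits M \<Longrightarrow> supp X \<subseteq> ground M"
    and "X \<in> circuits M \<Longrightarrow> opp X \<in> circuits M"
    and "X \<in> circuits M \<Longrightarrow> Y \<in> circuits M \<Longrightarrow> supp X \<subseteq> supp Y \<Longrightarrow> X = Y \<or> X = opp Y"
    and "X \<in> circuits M \<Longrightarrow> Y \<in> circuits M \<Longrightarrow> X \<noteq> opp Y \<Longrightarrow> e \<in> pos X \<inter> neg Y \<Longrightarrow>
      \<exists>Z\<in>circuits M. pos Z \<subseteq> (pos X \<union> pos Y) - {e} \<and> neg Z \<subseteq> (neg X \<union> neg Y) - {e}"
proof -
  note M = assms[unfolded oriented_matroid_def]
  show "finite (ground M)"
    by (rule M[THEN conjunct1])
  show "pos X \<inter> neg X = {}" if "X \<in> circuits M"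
    using M[THEN conjunct2, THEN conjunct1] that by simp
  show "supp X \<subseteq> ground M" if "X \<in> circuits M"
    using M[THEN conjunct2, THEN conjunct1] that by simp
  show "opp X \<in> circuits M" if "X \<in> circuits M"
    using M[THEN conjunct2, THEN conjunct2, THEN conjunct2, THEN conjunct1] that by (rule bspec)
  show "X = Y \<or> X = opp Y" if "X \<in> circuits M" "Y \<in> circuits M" "supp X \<subseteq> supp Y"
    using M[THEN conjunct2, THEN conjunct2, THEN conjunct2, THEN conjunct2, THEN conjunct1,
        rule_format, OF that] .
  show "\<exists>Z\<in>circuits M. pos Z \<subseteq> (pos X \<union> pos Y) - {e} \<and> neg Z \<subseteq> (neg X \<union> neg Y) - {e}"
    if "X \<in> circuits M" "Y \<in> circuits M" "X \<noteq> opp Y" "e \<in> pos X \<inter> neg Y"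
    using M[THEN conjunct2, THEN conjunct2, THEN conjunct2, THEN conjunct2, THEN conjunct2,
        rule_format, OF that(1,2) conjI[OF that(3,4)]] .
qed

text \<open>Signed elimination needs opposite signs at \<open>e\<close>, which can be arranged
  because a circuit and its opposite have the same support. Distinct supports rule out the excluded
  case \<open>X = opp Y\<close>.\<close>

lemma circuit_family_supports:
  assumes "oriented_matroid M"
  shows "circuit_family (supp ` circuits M)"
proof -
  note M = oriented_matroidD[OF assms]
  have supp_opp: "supp (opp X) = supp X" for X :: "'a signed_set"
    by (auto simp: supp_def opp_def)
  show ?thesis
  proof
    fix C assume "C \<in> supp ` circuits M"
    then show "finite C" using M(1,3) by (auto intro: finite_subset)
  next
    fix C D assume "C \<in> supp ` circuits M" "D \<in> supp ` circuits M" "C \<subseteq> D"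
    then obtain X Y where XY: "X \<in> circuits M" "Y \<in> circuits M" "C = supp X" "D = supp Y"
      "supp X \<subseteq> supp Y" by blast
    with M(5)[OF XY(1,2,5)] show "C = D" by (auto simp: supp_opp)
  next
    fix C D e
    assume CD: "C \<in> supp ` circuits M" "D \<in> supp ` circuits M" "C \<noteq> D" "e \<in> C \<inter> D"
    have elim: "\<exists>Z\<in>supp ` circuits M. Z \<subseteq> C \<union> D - {e}"
      if XY: "X \<in> circuits M" "Y \<in> circuits M" "supp X = C" "supp Y = D"
        "e \<in> pos X \<inter> neg Y" for X Y
    proof -
      have "X \<noteq> opp Y" using XY CD(3) supp_opp by metis
      then obtain Z where "Z \<in> circuits M" "pos Z \<subseteq> (pos X \<union> pos Y) - {e}"
        "neg Z \<subseteq> (neg X \<union> neg Y) - {e}"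
        using M(6)[OF XY(1,2) _ XY(5)] by blast
      with XY show ?thesis by (intro bexI[of _ "supp Z"]) (auto simp: supp_def)
    qed
    obtain X Y where XY: "X \<in> circuits M" "Y \<in> circuits M" "supp X = C" "supp Y = D"
      using CD by blast
    have opps: "opp X \<in> circuits M" "opp Y \<in> circuits M" using M(4) XY by auto
    \<comment> \<open>Signs are chosen so that \<open>e\<close> is positive in one circuit and
      negative in the other.\<close>
    have "\<exists>X'\<in>{X, opp X}. e \<in> pos X'" "\<exists>Y'\<in>{Y, opp Y}. e \<in> neg Y'"
      using XY CD(4) by (auto simp: supp_def opp_def)
    then obtain X' Y' where "X' \<in> {X, opp X}" "Y' \<in> {Y, opp Y}" "e \<in> pos X' \<inter> neg Y'"
      by blast
    then show "\<exists>Z\<in>supp ` circuits M. Z \<subseteq> C \<union> D - {e}"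
      using XY opps by (intro elim[of X' Y']) (auto simp: supp_opp)
  qed
qed

text \<open>Only transitivity has content: circuits through x, y and through y, z meet in y, so some
  circuit contains both x and z.\<close>

lemma equiv_connected_rel:
  assumes "oriented_matroid M"
  shows "equiv (ground M) (connected_rel M)"
proof (rule equivI)
  interpret circuit_family "supp ` circuits M"
    by (rule circuit_family_supports[OF assms])
  show "connected_rel M \<subseteq> ground M \<times> ground M"
    by (auto simp: connected_rel_def)
  show "refl_on (ground M) (connected_rel M)"
    by (auto simp: refl_on_def connected_rel_def)
  show "sym (connected_rel M)"
    by (auto simp: sym_def connected_rel_def)
  show "trans (connected_rel M)"
  proof (rule transI)
    fix x y z
    assume xy: "(x, y) \<in> connected_rel M" and yz: "(y, z) \<in> connected_rel M"
    show "(x, z) \<in> connected_rel M"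
    proof (cases "x = y \<or> y = z")
      case True
      with xy yz show ?thesis by auto
    next
      case False
      with xy yz obtain X Y where "X \<in> circuits M" "{x, y} \<subseteq> supp X"
        "Y \<in> circuits M" "{y, z} \<subseteq> supp Y"
        by (auto simp: connected_rel_def)
      then have "\<exists>Z\<in>supp ` circuits M. x \<in> Z \<and> z \<in> Z"
        by (intro circuit_through_meeting_circuits[of "supp X" "supp Y"]) auto
      with xy yz show ?thesis by (auto simp: connected_rel_def)
    qed
  qed
qed

section \<open>Unions of components and coinciding reorientations\<close>

text \<open>A saturated set is determined by the classes inside it. This turns the count of unions
  of components into the size of a power set.\<close>

lemma bij_betw_Union_saturated:
  assumes "equiv E r"
  shows "bij_betw Union (Pow (E // r)) {D. D \<subseteq> E \<and> r `` D \<subseteq> D}"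
proof (rule bij_betwI[where g = "\<lambda>D. {K \<in> E // r. K \<subseteq> D}"])
  show "Union \<in> Pow (E // r) \<rightarrow> {D. D \<subseteq> E \<and> r `` D \<subseteq> D}"
  proof
    fix P assume P: "P \<in> Pow (E // r)"
    have "\<Union>P \<subseteq> E" using P in_quotient_imp_subset[OF assms] by blast
    moreover have "r `` \<Union>P \<subseteq> \<Union>P"
      using P in_quotient_imp_closed[OF assms] by blast
    ultimately show "\<Union>P \<in> {D. D \<subseteq> E \<and> r `` D \<subseteq> D}" by blast
  qed
  show "(\<lambda>D. {K \<in> E // r. K \<subseteq> D}) \<in> {D. D \<subseteq> E \<and> r `` D \<subseteq> D} \<rightarrow> Pow (E // r)"
    by blast
next
  fix P assume P: "P \<in> Pow (E // r)"
  \<comment> \<open>A point of \<open>K\<close> lies in some class of \<open>P\<close>; as classes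
    are disjoint or equal, that class is \<open>K\<close>.\<close>
  have "K \<in> P" if K: "K \<in> E // r" "K \<subseteq> \<Union>P" for K
  proof -
    obtain x where x: "x \<in> K" using in_quotient_imp_non_empty[OF assms K(1)] by blast
    then obtain L where "L \<in> P" "x \<in> L" using K by blast
    with x K P quotient_disj[OF assms K(1), of L] show ?thesis by blast
  qed
  with P show "{K \<in> E // r. K \<subseteq> \<Union>P} = P" by blast
next
  fix D assume D: "D \<in> {D. D \<subseteq> E \<and> r `` D \<subseteq> D}"
  have "x \<in> \<Union>{K \<in> E // r. K \<subseteq> D}" if "x \<in> D" for x
  proof -
    have "x \<in> E" using D that by blast
    then have "r `` {x} \<in> E // r" "x \<in> r `` {x}"
      by (rule quotientI) (rule equiv_class_self[OF assms \<open>x \<in> E\<close>])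
    moreover have "r `` {x} \<subseteq> D" using D that by blast
    ultimately show ?thesis by blast
  qed
  then show "\<Union>{K \<in> E // r. K \<subseteq> D} = D" by blast
qed

lemma reverse_signs_eq_iff:
  assumes "pos X \<inter> neg X = {}"
  shows "reverse_signs A X = reverse_signs B X \<longleftrightarrow> sym_diff A B \<inter> supp X = {}"
  using assms unfolding reverse_signs_def supp_def prod_eq_iff fst_conv snd_conv by blast

text \<open>Passing to \<open>opp X\<close> flips every element of the support, so equality forces
  \<open>A\<close> and \<open>B\<close> to differ at each of them.\<close>

lemma reverse_signs_eq_opp_iff:
  assumes "pos X \<inter> neg X = {}"
  shows "reverse_signs A X = reverse_signs B (opp X) \<longleftrightarrow> supp X \<subseteq> sym_diff A B"
  using assms unfolding reverse_signs_def supp_def opp_def prod_eq_iff fst_conv snd_conv by blast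

text \<open>Reversal preserves supports, and a circuit with the support of \<open>X\<close> is
  \<open>X\<close> or \<open>opp X\<close>. Hence these two are the only possible sources of the
  reversed \<open>X\<close> in the other reorientation.\<close>

lemma reorient_eq_iff_circuits:
  assumes "oriented_matroid M"
  shows "reorient A M = reorient B M \<longleftrightarrow>
    (\<forall>X\<in>circuits M. sym_diff A B \<inter> supp X = {} \<or> supp X \<subseteq> sym_diff A B)"
proof -
  note M = oriented_matroidD[OF assms]
  have key: "reverse_signs A X \<in> reverse_signs B ` circuits M \<longleftrightarrow>
      sym_diff A B \<inter> supp X = {} \<or> supp X \<subseteq> sym_diff A B" if X: "X \<in> circuits M" for A B X
  proof
    assume "reverse_signs A X \<in> reverse_signs B ` circuits M"
    then obtain Y where Y: "Y \<in> circuits M" "reverse_signs A X = reverse_signs B Y" by blast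
    then have "supp Y = supp X" by (metis supp_reverse_signs)
    then have "Y = X \<or> Y = opp X" using M(5)[OF Y(1) X] by blast
    then show "sym_diff A B \<inter> supp X = {} \<or> supp X \<subseteq> sym_diff A B"
      using Y(2) M(2)[OF X] reverse_signs_eq_iff reverse_signs_eq_opp_iff by metis
  next
    assume "sym_diff A B \<inter> supp X = {} \<or> supp X \<subseteq> sym_diff A B"
    then have "reverse_signs A X = reverse_signs B X \<or> reverse_signs A X = reverse_signs B (opp X)"
      using M(2)[OF X] reverse_signs_eq_iff reverse_signs_eq_opp_iff by metis
    then show "reverse_signs A X \<in> reverse_signs B ` circuits M" using X M(4)[OF X] by blast
  qed
  have "reorient A M = reorient B M \<longleftrightarrow>
      (\<forall>X\<in>circuits M. reverse_signs A X \<in> reverse_signs B ` circuits M) \<and>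
      (\<forall>X\<in>circuits M. reverse_signs B X \<in> reverse_signs A ` circuits M)"
    unfolding reorient_def by auto
  \<comment> \<open>The condition in \<open>key\<close> is symmetric in \<open>A\<close> and
    \<open>B\<close>, so both inclusions reduce to it.\<close>
  then show ?thesis by (simp add: key Un_commute)
qed

text \<open>Any two elements of a circuit are related, so a circuit meeting a saturated
  \<open>D\<close> lies in \<open>D\<close>; the diagonal pairs impose nothing.\<close>

lemma saturated_connected_rel_iff:
  assumes "oriented_matroid M" "D \<subseteq> ground M"
  shows "connected_rel M `` D \<subseteq> D \<longleftrightarrow> (\<forall>X\<in>circuits M. D \<inter> supp X = {} \<or> supp X \<subseteq> D)"
proof -
  have "supp X \<subseteq> ground M" if "X \<in> circuits M" for X
    using oriented_matroidD(3)[OF assms(1) that] .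
  with assms(2) show ?thesis
    unfolding connected_rel_def by fast
qed

text \<open>Symmetric difference with \<open>B\<close> is an involution that carries the fibre onto
  the saturated sets, which are the unions of components.\<close>

lemma card_reorient_fibre:
  assumes "oriented_matroid M" "B \<subseteq> ground M"
  shows "card {A. A \<subseteq> ground M \<and> reorient A M = reorient B M} =
    2 ^ card (connected_components M)"
proof -
  let ?E = "ground M" and ?r = "connected_rel M"
  let ?S = "{D. D \<subseteq> ?E \<and> ?r `` D \<subseteq> D}"
  have iff: "reorient A M = reorient B M \<longleftrightarrow> ?r `` sym_diff A B \<subseteq> sym_diff A B"
    if "A \<subseteq> ?E" for A
  proof -
    have "sym_diff A B \<subseteq> ?E" using that assms(2) by blast
    then show ?thesis
      by (simp only: reorient_eq_iff_circuits[OF assms(1)] saturated_connected_rel_iff[OF assms(1)])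
  qed
  have involution: "sym_diff (sym_diff A B) B = A" for A :: "'a set" by blast
  have "bij_betw (\<lambda>A. sym_diff A B) {A. A \<subseteq> ?E \<and> reorient A M = reorient B M} ?S"
  proof (rule bij_betwI[where g = "\<lambda>D. sym_diff D B"])
    show "(\<lambda>A. sym_diff A B) \<in> {A. A \<subseteq> ?E \<and> reorient A M = reorient B M} \<rightarrow> ?S"
      using iff assms(2) by (simp add: Pi_iff) blast
    show "(\<lambda>D. sym_diff D B) \<in> ?S \<rightarrow> {A. A \<subseteq> ?E \<and> reorient A M = reorient B M}"
    proof
      fix D assume D: "D \<in> ?S"
      then have "sym_diff D B \<subseteq> ?E" using assms(2) by blast
      with D show "sym_diff D B \<in> {A. A \<subseteq> ?E \<and> reorient A M = reorient B M}"
        using iff[of "sym_diff D B"] by (simp only: involution mem_Collect_eq)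
    qed
  qed (simp_all only: involution)
  then have "card {A. A \<subseteq> ?E \<and> reorient A M = reorient B M} = card ?S"
    by (rule bij_betw_same_card)
  also have "\<dots> = card (Pow (?E // ?r))"
    using bij_betw_Union_saturated[OF equiv_connected_rel[OF assms(1)]]
    by (rule bij_betw_same_card[symmetric])
  also have "\<dots> = 2 ^ card (?E // ?r)"
  proof (rule card_Pow)
    show "finite (?E // ?r)"
      using oriented_matroidD(1)[OF assms(1)]
      by (rule finite_quotient) (auto simp: connected_rel_def)
  qed
  finally show ?thesis by (simp add: connected_components_def)
qed

section \<open>Colourings and acyclic reorientations\<close>

lemma acyclic_reorient_iff:
  "acyclic_om (reorient A M) \<longleftrightarrow> \<not> (\<exists>X\<in>circuits M. neg X \<subseteq> A \<and> pos X \<inter> A = {})"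
  by (auto simp: acyclic_om_def reorient_def reverse_signs_def)

lemma transitive_coloring_iff_acyclic_reorient:
  assumes "oriented_matroid M" "acyclic_om M" and \<epsilon>: "\<epsilon> \<in> ground M \<rightarrow>\<^sub>E {1, 2::nat}"
  shows "\<epsilon> \<in> transitive_2_colorings M \<longleftrightarrow>
    acyclic_om (reorient {e \<in> ground M. \<epsilon> e = 2} M)"
proof -
  note M = oriented_matroidD[OF assms(1)]
  let ?A = "{e \<in> ground M. \<epsilon> e = 2}"
  have color: "\<epsilon> e = 1 \<or> \<epsilon> e = 2" if "e \<in> ground M" for e
    using \<epsilon> that by auto
  have iff: "\<epsilon> ` pos X \<inter> \<epsilon> ` neg X = {} \<longleftrightarrow>
      neg X \<subseteq> ?A \<and> pos X \<inter> ?A = {} \<or> pos X \<subseteq> ?A \<and> neg X \<inter> ?A = {}"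
    if X: "X \<in> circuits M" for X
  proof
    have sub: "pos X \<subseteq> ground M" "neg X \<subseteq> ground M"
      using M(3)[OF X] by (auto simp: supp_def)
    \<comment> \<open>Acyclicity, applied to \<open>X\<close> and to \<open>opp X\<close>, makes
      both parts nonempty. The colour of one \<open>p\<close> then fixes the colour of all of
      \<open>neg X\<close>, and \<open>n\<close> fixes that of \<open>pos X\<close>.\<close>
    have "opp X \<in> circuits M" using M(4) X by blast
    then have ne: "pos X \<noteq> {}" "neg X \<noteq> {}"
      using assms(2) X by (force simp: acyclic_om_def opp_def)+
    then obtain p n where pn: "p \<in> pos X" "n \<in> neg X" by blast
    assume disj: "\<epsilon> ` pos X \<inter> \<epsilon> ` neg X = {}"
    have differ: "\<epsilon> e \<noteq> \<epsilon> f" if "e \<in> pos X" "f \<in> neg X" for e f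
      using disj that by blast
    have range: "\<epsilon> e = 1 \<or> \<epsilon> e = 2" if "e \<in> pos X \<union> neg X" for e
      using color sub that by blast
    show "neg X \<subseteq> ?A \<and> pos X \<inter> ?A = {} \<or> pos X \<subseteq> ?A \<and> neg X \<inter> ?A = {}"
    proof (cases "\<epsilon> p = 2")
      case True
      then have "\<epsilon> f = 1" if "f \<in> neg X" for f
        using differ[OF pn(1) that] range[of f] that by auto
      moreover from this have "\<epsilon> e = 2" if "e \<in> pos X" for e
        using differ[OF that pn(2)] range[of e] that pn by auto
      ultimately show ?thesis using sub by auto
    next
      case False
      then have "\<epsilon> f = 2" if "f \<in> neg X" for f
        using differ[OF pn(1) that] range[of f] range[of p] that pn by auto
      moreover from this have "\<epsilon> e = 1" if "e \<in> pos X" for e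
        using differ[OF that pn(2)] range[of e] that pn by auto
      ultimately show ?thesis using sub by auto
    qed
  next
    have sub: "pos X \<subseteq> ground M" "neg X \<subseteq> ground M"
      using M(3)[OF X] by (auto simp: supp_def)
    assume "neg X \<subseteq> ?A \<and> pos X \<inter> ?A = {} \<or> pos X \<subseteq> ?A \<and> neg X \<inter> ?A = {}"
    then show "\<epsilon> ` pos X \<inter> \<epsilon> ` neg X = {}"
      using sub by (auto 0 3)
  qed
  have "(\<exists>X\<in>circuits M. \<epsilon> ` pos X \<inter> \<epsilon> ` neg X = {}) \<longleftrightarrow>
      (\<exists>X\<in>circuits M. neg X \<subseteq> ?A \<and> pos X \<inter> ?A = {})"
  proof
    assume "\<exists>X\<in>circuits M. \<epsilon> ` pos X \<inter> \<epsilon> ` neg X = {}"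
    then obtain X where X: "X \<in> circuits M"
      "neg X \<subseteq> ?A \<and> pos X \<inter> ?A = {} \<or> pos X \<subseteq> ?A \<and> neg X \<inter> ?A = {}"
      using iff by blast
    \<comment> \<open>The second alternative is the first one for \<open>opp X\<close>, so it
      suffices to look for circuits that become positive.\<close>
    then have "(neg X \<subseteq> ?A \<and> pos X \<inter> ?A = {}) \<or> (neg (opp X) \<subseteq> ?A \<and> pos (opp X) \<inter> ?A = {})"
      by (simp add: opp_def)
    with X(1) M(4)[OF X(1)] show "\<exists>X\<in>circuits M. neg X \<subseteq> ?A \<and> pos X \<inter> ?A = {}"
      by blast
  next
    assume "\<exists>X\<in>circuits M. neg X \<subseteq> ?A \<and> pos X \<inter> ?A = {}"
    with iff show "\<exists>X\<in>circuits M. \<epsilon> ` pos X \<inter> \<epsilon> ` neg X = {}" by blast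
  qed
  moreover have "\<epsilon> \<in> transitive_2_colorings M \<longleftrightarrow>
      \<not> (\<exists>X\<in>circuits M. \<epsilon> ` pos X \<inter> \<epsilon> ` neg X = {})"
    using \<epsilon> by (simp add: transitive_2_colorings_def)
  ultimately show ?thesis
    by (simp only: acyclic_reorient_iff)
qed

lemma card_transitive_2_colorings:
  assumes "oriented_matroid M" "acyclic_om M"
  shows "card (transitive_2_colorings M) =
    card {A. A \<subseteq> ground M \<and> acyclic_om (reorient A M)}"
proof -
  let ?E = "ground M"
  let ?set = "\<lambda>\<epsilon>. {e \<in> ?E. \<epsilon> e = (2::nat)}"
  \<comment> \<open>The bounded abstraction leaves values outside the ground set undefined, as the
    extensional function space requires.\<close>
  let ?col = "\<lambda>A. \<lambda>e\<in>?E. if e \<in> A then 2 else (1::nat)"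
  have col: "?col A \<in> ?E \<rightarrow>\<^sub>E {1, 2}" for A by auto
  have set_col: "?set (?col A) = A" if "A \<subseteq> ?E" for A using that by auto
  have ext: "\<epsilon> \<in> ?E \<rightarrow>\<^sub>E {1, 2}" if "\<epsilon> \<in> transitive_2_colorings M" for \<epsilon>
    using that by (simp add: transitive_2_colorings_def)
  have "bij_betw ?set (transitive_2_colorings M) {A. A \<subseteq> ?E \<and> acyclic_om (reorient A M)}"
  proof (rule bij_betwI[where g = ?col])
    show "?set \<in> transitive_2_colorings M \<rightarrow> {A. A \<subseteq> ?E \<and> acyclic_om (reorient A M)}"
      using transitive_coloring_iff_acyclic_reorient[OF assms] ext by blast
    show "?col \<in> {A. A \<subseteq> ?E \<and> acyclic_om (reorient A M)} \<rightarrow> transitive_2_colorings M"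
    proof
      fix A assume "A \<in> {A. A \<subseteq> ?E \<and> acyclic_om (reorient A M)}"
      then show "?col A \<in> transitive_2_colorings M"
        by (simp only: transitive_coloring_iff_acyclic_reorient[OF assms col] set_col mem_Collect_eq)
    qed
    show "?col (?set \<epsilon>) = \<epsilon>" if "\<epsilon> \<in> transitive_2_colorings M" for \<epsilon>
      using ext[OF that] by (auto simp: fun_eq_iff PiE_iff extensional_def restrict_def)
    show "?set (?col A) = A" if "A \<in> {A. A \<subseteq> ?E \<and> acyclic_om (reorient A M)}" for A
      using that by (intro set_col) simp
  qed
  then show ?thesis by (rule bij_betw_same_card)
qed

theorem theorem1p16:
  fixes M :: "'a om"
  assumes "oriented_matroid M"
    and "ground M \<noteq> {}"
    and "acyclic_om M"
  shows "card (transitive_2_colorings M) =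
    2 ^ card (connected_components M) * card {N \<in> reorientations M. acyclic_om N}"
proof -
  let ?G = "{A. A \<subseteq> ground M \<and> acyclic_om (reorient A M)}"
  let ?R = "{N \<in> reorientations M. acyclic_om N}"
  have fin: "finite ?G"
    using oriented_matroidD(1)[OF assms(1)] by simp
  have R: "?R = (\<lambda>A. reorient A M) ` ?G"
    by (auto simp: reorientations_def)
  have "card {A \<in> ?G. reorient A M = N} = 2 ^ card (connected_components M)" if "N \<in> ?R" for N
  proof -
    from that obtain B where B: "B \<subseteq> ground M" "N = reorient B M"
      by (auto simp: reorientations_def)
    \<comment> \<open>Acyclicity depends only on the reorientation \<open>N\<close>, so
      \<open>?G\<close> contains the whole fibre over \<open>N\<close>.\<close>
    with that have "{A \<in> ?G. reorient A M = N} =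
        {A. A \<subseteq> ground M \<and> reorient A M = reorient B M}" by auto
    with card_reorient_fibre[OF assms(1) B(1)] show ?thesis by simp
  qed
  \<comment> \<open>Summing the constant 1 over \<open>?G\<close>, grouped by the resulting
    reorientation, adds up the fibre sizes.\<close>
  then have "card ?G = (\<Sum>N\<in>?R. 2 ^ card (connected_components M))"
    using sum.group[OF fin _ order_refl, of "\<lambda>A. reorient A M" "\<lambda>_. 1::nat"] fin
    unfolding R by simp
  then show ?thesis
    by (simp add: card_transitive_2_colorings[OF assms(1,3)])
qed

end
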